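(* Let $B$ be the simplicial complex on vertex set $\{v_1,\dots,v_5\}$ whose edge set is the downward closure of $\{v_3v_4,\ v_1v_2v_3,\ v_1v_4v_5\}$. There is a constant $C\in\mathbb N$ such that for every $n\ge 5$, $$\mathrm{ex}(n,B)\le \frac98\binom n2+\frac{21}{16}n+C.$$
   Context: A simplicial complex is a pair $H=(V,E)$ with $E\subseteq\mathscr P(V)$ closed under taking subsets; all subsets of $E$ (including the empty set and singletons) count as edges. $H$ contains a copy of $F$ if there is an injection $\varphi:V(F)\to V(H)$ with $\varphi(e)\in E(H)$ for every $e\in E(F)$. $\mathrm{ex}(n,F)$ is the maximum number of edges of a simplicial complex on $n$ vertices containing no copy of $F$. *)

theory Defs
  imports Complex_Main
begin

type_synonym 'a complex_pair = "'a set \<times> 'a set set"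

abbreviation verts :: "'a complex_pair \<Rightarrow> 'a set" where
  "verts H \<equiv> fst H"

abbreviation edges :: "'a complex_pair \<Rightarrow> 'a set set" where
  "edges H \<equiv> snd H"

text \<open>Nothing forces the singletons of all vertices to be edges, and the edge set may be empty.\<close>

definition simplicial_complex :: "'a complex_pair \<Rightarrow> bool" where
  "simplicial_complex H \<longleftrightarrow>
     edges H \<subseteq> Pow (verts H) \<and> (\<forall>e \<in> edges H. \<forall>f. f \<subseteq> e \<longrightarrow> f \<in> edges H)"

definition contains_copy :: "'a complex_pair \<Rightarrow> 'b complex_pair \<Rightarrow> bool" where
  "contains_copy H F \<longleftrightarrow>
     (\<exists>\<phi>. inj_on \<phi> (verts F) \<and> \<phi> ` verts F \<subseteq> verts H \<and>
          (\<forall>e \<in> edges F. \<phi> ` e \<in> edges H))"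

text \<open>
  The vertices of the host complexes are taken to be natural numbers, which loses nothing since
  every finite complex has an isomorphic copy of this kind; see \<open>card_edges_le_ex_number\<close>.
\<close>

definition ex_number :: "nat \<Rightarrow> 'b complex_pair \<Rightarrow> nat" where
  "ex_number n F =
     Max {card (edges H) | H :: nat complex_pair.
            simplicial_complex H \<and> finite (verts H) \<and> card (verts H) = n \<and> \<not> contains_copy H F}"

definition downward_closure :: "'a set set \<Rightarrow> 'a set set" where
  "downward_closure M = {e. \<exists>m \<in> M. e \<subseteq> m}"

definition B_complex :: "nat complex_pair" where
  "B_complex = ({1, 2, 3, 4, 5}, downward_closure {{3, 4}, {1, 2, 3}, {1, 4, 5}})"

lemma simplicial_complex_B: "simplicial_complex B_complex"
  unfolding simplicial_complex_def B_complex_def downward_closure_def by auto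

lemma finite_ex_number_set:
  "finite {card (edges H) | H :: nat complex_pair.
     simplicial_complex H \<and> finite (verts H) \<and> card (verts H) = n \<and> \<not> contains_copy H F}"
proof (rule finite_subset)
  show "{card (edges H) | H :: nat complex_pair.
     simplicial_complex H \<and> finite (verts H) \<and> card (verts H) = n \<and> \<not> contains_copy H F}
     \<subseteq> {..2 ^ n}"
    unfolding simplicial_complex_def
    by (auto simp: card_Pow[symmetric] intro!: card_mono)
qed simp

lemma ex_number_set_nonempty:
  assumes "edges F \<noteq> {}"
  shows "{card (edges H) | H :: nat complex_pair.
     simplicial_complex H \<and> finite (verts H) \<and> card (verts H) = n \<and> \<not> contains_copy H F} \<noteq> {}"
proof -
  have "simplicial_complex ({..<n}, {}) \<and> finite (verts ({..<n}, {})) \<and>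
      card (verts ({..<n}, {})) = n \<and> \<not> contains_copy ({..<n}, {}) F"
    using assms unfolding simplicial_complex_def contains_copy_def by auto
  then show ?thesis by blast
qed

lemma card_edges_le_ex_number:
  fixes H :: "'a complex_pair" and F :: "'b complex_pair"
  assumes H: "simplicial_complex H" "finite (verts H)" "card (verts H) = n"
    and free: "\<not> contains_copy H F"
  shows "card (edges H) \<le> ex_number n F"
proof -
  from H(2,3) obtain g :: "'a \<Rightarrow> nat" where g: "bij_betw g (verts H) {..<n}"
    using ex_bij_betw_finite_nat[of "verts H"] by (auto simp: atLeast0LessThan)
  let ?G = "(g ` verts H, (`) g ` edges H)"
  have inj: "inj_on g (verts H)" using g by (rule bij_betw_imp_inj_on)
  have sub: "edges H \<subseteq> Pow (verts H)" using H(1) by (simp add: simplicial_complex_def)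
  have "simplicial_complex ?G"
    unfolding simplicial_complex_def
  proof (intro conjI ballI allI impI)
    show "edges ?G \<subseteq> Pow (verts ?G)" using sub by auto
    fix e f assume "e \<in> edges ?G" "f \<subseteq> e"
    then obtain d where d: "d \<in> edges H" "f \<subseteq> g ` d" by auto
    then obtain c where "c \<subseteq> d" "f = g ` c" by (auto simp: subset_image_iff)
    with d H(1) show "f \<in> edges ?G" by (auto simp: simplicial_complex_def)
  qed
  moreover have "\<not> contains_copy ?G F"
  proof
    assume "contains_copy ?G F"
    then obtain p where p: "inj_on p (verts F)" "p ` verts F \<subseteq> g ` verts H"
      and pe: "\<And>e. e \<in> edges F \<Longrightarrow> p ` e \<in> (`) g ` edges H"
      unfolding contains_copy_def by auto
    define q where "q = inv_into (verts H) g \<circ> p"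
    have "inj_on q (verts F)"
      unfolding q_def using p by (intro comp_inj_on inj_on_inv_into) auto
    moreover have "q ` verts F \<subseteq> verts H"
      unfolding q_def using p(2) inv_into_into[of _ g "verts H"] by fastforce
    moreover have "q ` e \<in> edges H" if e: "e \<in> edges F" for e
    proof -
      from pe[OF e] obtain d where d: "d \<in> edges H" "p ` e = g ` d" by auto
      have "q ` e = inv_into (verts H) g ` (g ` d)"
        unfolding q_def image_comp[symmetric] d(2) ..
      also have "\<dots> = d" using inj sub d(1) by (intro inv_into_image_cancel) auto
      finally show ?thesis using d(1) by simp
    qed
    ultimately have "contains_copy H F" unfolding contains_copy_def by blast
    with free show False ..
  qed
  moreover have "finite (verts ?G)" "card (verts ?G) = n"
    using H(2,3) inj by (auto simp: card_image)
  moreover have "card (edges ?G) = card (edges H)"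
    using inj_on_image_Pow[OF inj] sub by (auto intro!: card_image intro: inj_on_subset)
  ultimately have "card (edges H) \<in> {card (edges H) | H :: nat complex_pair.
     simplicial_complex H \<and> finite (verts H) \<and> card (verts H) = n \<and> \<not> contains_copy H F}"
    by (metis (mono_tags, lifting) mem_Collect_eq)
  then show ?thesis unfolding ex_number_def using finite_ex_number_set by (rule Max_ge[rotated])
qed

end

theory Submission
  imports Defs
begin

text \<open>
  In a \<open>B\<close>-free complex, two triangles meeting in exactly one vertex \<open>v\<close> have no edge between
  their remaining pairs. Hence sharing at least two vertices is an equivalence relation on the
  triangles; its classes (blocks) are books, i.e. triangles on a common spine edge, or live on
  four vertices. A book with \<open>k\<close> pages gives weight 1 to each page, a four-vertex block gives
  \<open>5/4\<close> to each vertex, which pays for its at most four triangles and its possible 4-edge.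

  Let \<open>v\<close> be a vertex of maximal total weight \<open>m\<close>, and let \<open>S\<close> be the set of vertices that the
  blocks give \<open>v\<close> as link; \<open>S\<close> has about \<open>2m\<close> vertices and about \<open>2m\<^sup>2\<close> missing pairs. Outside
  \<open>S\<close> the weight is at most \<open>m(n - |S|)\<close>; the weight of a vertex \<open>s \<in> S\<close> is paid for by missing
  pairs between the other vertices of its block and the links of the further blocks at \<open>s\<close>.
  Up to a constant, the triangles thus exceed the missing pairs by at most
  \<open>m(n - 4m + 2) \<le> (n + 2)\<^sup>2/16\<close>.
\<close>

section \<open>Weighted counting of missing pairs\<close>

text \<open>Two and three are the link sizes in a book and in a four-vertex block. The cyclic shift
  will move a link vertex to another vertex of the same link.\<close>

lemma fixpoint_free_permutation:
  assumes "card A = 2 \<or> card A = 3"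
  shows "\<exists>\<sigma>. inj_on \<sigma> A \<and> (\<forall>x\<in>A. \<sigma> x \<in> A - {x})"
  using assms
proof
  assume "card A = 2"
  then obtain x y where "A = {x, y}" "x \<noteq> y" by (auto simp: card_2_iff)
  then show ?thesis
    by (intro exI[of _ "\<lambda>u. if u = x then y else x"]) (auto simp: inj_on_def)
next
  assume "card A = 3"
  then obtain x y z where "A = {x, y, z}" "x \<noteq> y" "y \<noteq> z" "x \<noteq> z" by (auto simp: card_3_iff)
  then show ?thesis
    by (intro exI[of _ "\<lambda>u. if u = x then y else if u = y then z else x"]) (auto simp: inj_on_def)
qed

text \<open>Here \<open>c\<close> and \<open>a\<close> count the books and the four-vertex blocks
  that give weight to the chosen vertex, \<open>m\<close> is its weight, \<open>s\<close> is the
  size of \<open>S\<close>, and \<open>4 * c + 9 * a\<close> counts the ordered pairs inside a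
  single link.\<close>

lemma quadratic_optimization:
  fixes n m s :: real and a c :: nat
  defines "m \<equiv> real c + 5 / 4 * real a" and "s \<equiv> 2 * real c + 3 * real a"
  shows "m * (n - s) + 15 / 4 * a \<le> (s\<^sup>2 - (4 * c + 9 * a)) / 2 + (n + 2)\<^sup>2 / 16 + 5"
proof -
  \<comment> \<open>Completing squares: the first square is optimal at
    \<open>m = (n + 2) / 8\<close>, the second completes \<open>2 * a^2 - 23/4 * a\<close>. Its
    remainder 529/128 is absorbed by the constant 5, which leaves 111/128.\<close>
  have "(s\<^sup>2 - (4 * c + 9 * a)) / 2 + (n + 2)\<^sup>2 / 16 + 5 - (m * (n - s) + 15 / 4 * a)
      = (n + 2 - 8 * m)\<^sup>2 / 16 + 3 / 2 * (real a * real c) + 2 * (real a - 23 / 16)\<^sup>2 + 111 / 128"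
    unfolding m_def s_def by (simp add: power2_eq_square field_simps)
  also have "\<dots> \<ge> 0" by simp
  finally show ?thesis by simp
qed

text \<open>
  Abstract counting: \<open>R\<close> is the set of ordered missing pairs, \<open>act b\<close> the set of vertices
  receiving weight from the block \<open>b\<close>, \<open>A b v\<close> the vertices of the link of \<open>v\<close> in \<open>b\<close>, and \<open>D\<close>
  the set of four-vertex blocks.
\<close>

lemma weighted_block_bound:
  fixes V :: "'a set" and Bl D :: "'b set" and act :: "'b \<Rightarrow> 'a set" and A :: "'b \<Rightarrow> 'a \<Rightarrow> 'a set"
  assumes fin: "finite V" "finite Bl"
    and actV: "\<And>b. b \<in> Bl \<Longrightarrow> act b \<subseteq> V"
    and R: "R \<subseteq> V \<times> V"
    and AV: "\<And>b v. b \<in> Bl \<Longrightarrow> A b v \<subseteq> V"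
    and cardA: "\<And>b v. b \<in> Bl \<Longrightarrow> v \<in> act b \<Longrightarrow> card (A b v) = (if b \<in> D then 3 else 2)"
    and dj: "\<And>b b' v. b \<in> Bl \<Longrightarrow> b' \<in> Bl \<Longrightarrow> b \<noteq> b' \<Longrightarrow> A b v \<inter> A b' v = {}"
    and nonadj: "\<And>b b' v. b \<in> Bl \<Longrightarrow> b' \<in> Bl \<Longrightarrow> b \<noteq> b' \<Longrightarrow> A b v \<times> A b' v \<subseteq> R"
    and trans: "\<And>b v s. b \<in> Bl \<Longrightarrow> v \<in> act b \<Longrightarrow> s \<in> A b v \<Longrightarrow> insert v (A b v) - {s} \<subseteq> A b s"
    and adj: "\<And>b v s. b \<in> Bl \<Longrightarrow> s \<in> A b v \<Longrightarrow> (v, s) \<notin> R"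
    and loop: "\<And>b v. b \<in> Bl \<Longrightarrow> v \<notin> A b v"
    and inact: "\<And>b v s. b \<in> Bl \<Longrightarrow> b \<notin> D \<Longrightarrow> v \<in> act b \<Longrightarrow> s \<in> A b v \<Longrightarrow> s \<notin> act b"
  shows "(\<Sum>b\<in>Bl. (if b \<in> D then 5 / 4 else 1) * real (card (act b)))
           \<le> real (card R) / 2 + (real (card V) + 2)\<^sup>2 / 16 + 5"
proof (cases "V = {}")
  case True
  have "(\<Sum>b\<in>Bl. (if b \<in> D then 5 / 4 else 1) * real (card (act b))) = 0"
    using True actV by (intro sum.neutral) auto
  then show ?thesis by simp
next
  case False
  define w :: "'b \<Rightarrow> real" where "w b = (if b \<in> D then 5 / 4 else 1)" for b
  define p where "p v = (\<Sum>b\<in>{b\<in>Bl. v \<in> act b}. w b)" for v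
  have fA: "finite (A b v)" if "b \<in> Bl" for b v using AV[OF that] fin(1) finite_subset by blast
  have fR: "finite R" using R fin(1) finite_subset by blast
  \<comment> \<open>Double counting: \<open>p v\<close> is the total weight that \<open>v\<close>
    receives, so the bound may be proved vertex by vertex.\<close>
  have swap: "(\<Sum>b\<in>Bl. w b * real (card (act b))) = (\<Sum>v\<in>V. p v)"
  proof -
    have "(\<Sum>b\<in>Bl. w b * real (card (act b))) = (\<Sum>b\<in>Bl. \<Sum>v\<in>{v\<in>V. v \<in> act b}. w b)"
    proof (rule sum.cong)
      fix b assume "b \<in> Bl"
      then have "{v\<in>V. v \<in> act b} = act b" using actV by blast
      then show "w b * real (card (act b)) = (\<Sum>v\<in>{v\<in>V. v \<in> act b}. w b)" by simp
    qed simp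
    also have "\<dots> = (\<Sum>v\<in>V. p v)" unfolding p_def using fin by (intro sum.swap_restrict)
    finally show ?thesis .
  qed
  obtain v where v: "v \<in> V" and vmax: "\<And>u. u \<in> V \<Longrightarrow> p u \<le> p v"
  proof -
    have "Max (p ` V) \<in> p ` V" using fin False by (intro Max_in) auto
    then obtain v where "v \<in> V" "p v = Max (p ` V)" by auto
    then show thesis using that fin by simp
  qed
  define Bv where "Bv = {b\<in>Bl. v \<in> act b}"
  define c where "c = card (Bv - D)"
  define a where "a = card (Bv \<inter> D)"
  have fBv: "finite Bv" using fin by (simp add: Bv_def)
  have split: "(\<Sum>b\<in>Bv. if b \<in> D then x else y) = x * real a + y * real c" for x y :: real
    using fBv by (simp add: sum.If_cases a_def c_def Diff_eq)
  have pv: "p v = real c + 5 / 4 * real a"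
    using split[of "5/4" 1] by (simp add: p_def w_def Bv_def)
  define S where "S = (\<Union>b\<in>Bv. A b v)"
  have SV: "S \<subseteq> V" using AV by (auto simp: S_def Bv_def)
  have fS: "finite S" using SV fin(1) finite_subset by blast
  have cA: "real (card (A b v)) = (if b \<in> D then 3 else 2)" if "b \<in> Bv" for b
    using cardA[of b v] that by (simp add: Bv_def)
  have cardS: "real (card S) = 2 * real c + 3 * real a"
  proof -
    have "card S = (\<Sum>b\<in>Bv. card (A b v))"
      unfolding S_def using fBv fA dj by (intro card_UN_disjoint) (auto simp: Bv_def)
    then have "real (card S) = (\<Sum>b\<in>Bv. if b \<in> D then 3 else 2)" using cA by simp
    then show ?thesis using split[of 3 2] by simp
  qed

  \<comment> \<open>Links of \<open>v\<close> in distinct blocks are disjoint and completely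
    non-adjacent. Removing the pairs inside one link, which include the diagonal of
    \<open>S\<close>, therefore leaves only missing pairs.\<close>
  define P where "P = (\<Union>b\<in>Bv. A b v \<times> A b v)"
  define N1 where "N1 = S \<times> S - P"
  have N1R: "N1 \<subseteq> R"
  proof
    fix z assume z: "z \<in> N1"
    obtain x y where zxy: "z = (x, y)" by (cases z)
    from z zxy obtain b b' where "b \<in> Bv" "b' \<in> Bv" "x \<in> A b v" "y \<in> A b' v"
      by (auto simp: N1_def S_def)
    moreover from this z zxy have "b \<noteq> b'" by (auto simp: N1_def P_def)
    ultimately show "z \<in> R" using nonadj[of b b' v] zxy by (auto simp: Bv_def)
  qed
  have cardN1: "real (card N1) = (real (card S))\<^sup>2 - (4 * real c + 9 * real a)"
  proof -
    have "card P = (\<Sum>b\<in>Bv. card (A b v \<times> A b v))"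
      unfolding P_def using fBv fA dj by (intro card_UN_disjoint) (fastforce simp: Bv_def)+
    then have "real (card P) = (\<Sum>b\<in>Bv. if b \<in> D then 9 else 4)"
      using cA by (simp add: card_cartesian_product) (auto intro!: sum.cong)
    then have cP: "real (card P) = 4 * real c + 9 * real a" using split[of 9 4] by simp
    have PS: "P \<subseteq> S \<times> S" by (auto simp: P_def S_def)
    then have "finite P" using fS finite_subset by blast
    then have "card N1 = card (S \<times> S) - card P" unfolding N1_def using PS by (rule card_Diff_subset)
    moreover have "card P \<le> card (S \<times> S)" using PS fS by (intro card_mono) auto
    ultimately have "real (card N1) = real (card (S \<times> S)) - real (card P)" by simp
    then show ?thesis using cP by (simp add: card_cartesian_product power2_eq_square)
  qed

  have "\<forall>s\<in>S. \<exists>b. b \<in> Bv \<and> s \<in> A b v" by (auto simp: S_def)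
  then obtain bl where bl: "\<And>s. s \<in> S \<Longrightarrow> bl s \<in> Bv" "\<And>s. s \<in> S \<Longrightarrow> s \<in> A (bl s) v"
    by metis
  have bl_eq: "bl s = b" if "b \<in> Bv" "s \<in> A b v" for b s
  proof -
    have "s \<in> S" using that by (auto simp: S_def)
    then show ?thesis using bl[of s] that dj[of "bl s" b v] by (auto simp: Bv_def)
  qed
  have "\<forall>b\<in>Bv. \<exists>\<sigma>. inj_on \<sigma> (A b v) \<and> (\<forall>x\<in>A b v. \<sigma> x \<in> A b v - {x})"
  proof
    fix b assume "b \<in> Bv"
    then have "card (A b v) = 2 \<or> card (A b v) = 3" using cardA[of b v] by (auto simp: Bv_def)
    then show "\<exists>\<sigma>. inj_on \<sigma> (A b v) \<and> (\<forall>x\<in>A b v. \<sigma> x \<in> A b v - {x})"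
      by (rule fixpoint_free_permutation)
  qed
  then obtain \<tau> where \<tau>: "\<And>b. b \<in> Bv \<Longrightarrow> inj_on (\<tau> b) (A b v)"
    "\<And>b x. b \<in> Bv \<Longrightarrow> x \<in> A b v \<Longrightarrow> \<tau> b x \<in> A b v - {x}"
    by metis
  define \<sigma> where "\<sigma> s = \<tau> (bl s) s" for s
  have \<sigma>: "\<sigma> s \<in> A (bl s) v - {s}" if "s \<in> S" for s
    using \<tau>(2) bl that by (simp add: \<sigma>_def)
  have \<sigma>S: "\<sigma> s \<in> S" if "s \<in> S" for s using \<sigma>[OF that] bl(1)[OF that] by (auto simp: S_def)
  have inj\<sigma>: "inj_on \<sigma> S"
  proof (rule inj_onI)
    fix s s' assume s: "s \<in> S" "s' \<in> S" "\<sigma> s = \<sigma> s'"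
    have "bl (\<sigma> s) = bl s" "bl (\<sigma> s') = bl s'" using bl_eq \<sigma> bl(1) s(1,2) by blast+
    then have "bl s = bl s'" using s(3) by simp
    then show "s = s'"
      using s \<tau>(1)[of "bl s"] bl[of s] bl[of s'] by (auto simp: \<sigma>_def dest: inj_onD)
  qed
  define B' where "B' s = {b\<in>Bl. s \<in> act b} - {bl s}" for s
  have fB': "finite (B' s)" for s using fin by (simp add: B'_def)
  have B'Bl: "b \<in> Bl" "s \<in> act b" "b \<noteq> bl s" if "b \<in> B' s" for b s using that by (auto simp: B'_def)
  define U where "U s = (\<Union>b\<in>B' s. A b s)" for s
  \<comment> \<open>By \<open>trans\<close>, \<open>v\<close> and the block mates of
    \<open>s\<close> lie in the link of \<open>s\<close> in \<open>bl s\<close>, while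
    \<open>U s\<close> consists of links of \<open>s\<close> in other blocks; so
    \<open>nonadj\<close> applies at \<open>s\<close>.\<close>
  have UR: "(x, u) \<in> R" if "s \<in> S" "u \<in> U s" "x \<in> insert v (A (bl s) v) - {s}" for s u x
  proof -
    obtain b where b: "b \<in> B' s" "u \<in> A b s" using \<open>u \<in> U s\<close> by (auto simp: U_def)
    have "x \<in> A (bl s) s" using trans[of "bl s" v s] bl[OF that(1)] that(3) by (auto simp: Bv_def)
    moreover have "bl s \<in> Bl" using bl[OF that(1)] by (auto simp: Bv_def)
    ultimately show ?thesis using nonadj[of "bl s" b s] B'Bl[OF b(1)] b(2) by auto
  qed
  \<comment> \<open>By \<open>adj\<close>, no vertex of \<open>S\<close> is missing from the
    neighbourhood of \<open>v\<close>, whereas \<open>UR\<close> with \<open>x = v\<close> makes all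
    pairs from \<open>v\<close> to \<open>U s\<close> missing.\<close>
  have US: "u \<notin> S" if "s \<in> S" "u \<in> U s" for s u
  proof
    assume "u \<in> S"
    then have "(v, u) \<notin> R" using adj[of "bl u" u v] bl[of u] by (auto simp: Bv_def)
    moreover have "v \<noteq> s" using loop[of "bl s" v] bl[OF that(1)] by (auto simp: Bv_def)
    ultimately show False using UR[OF that, of v] by auto
  qed
  \<comment> \<open>The shift by \<open>\<sigma>\<close> is needed because \<open>s\<close> itself is adjacent to \<open>U s\<close>, while its block mates are not;
    injectivity of \<open>\<sigma>\<close> keeps the pairs for different \<open>s\<close> distinct.\<close>
  define N2 where "N2 = (\<Union>s\<in>S. {\<sigma> s} \<times> U s)"
  have N2R: "N2 \<subseteq> R" using UR \<sigma> by (auto simp: N2_def)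
  have fU: "finite (U s)" for s using fB' fA B'Bl by (auto simp: U_def)
  \<comment> \<open>A link of size 2 goes with weight 1 and one of size 3 with weight 5/4, so its
    size is at least twice the weight.\<close>
  have cardU: "2 * (\<Sum>b\<in>B' s. w b) \<le> real (card (U s))" for s
  proof -
    have "card (U s) = (\<Sum>b\<in>B' s. card (A b s))"
      unfolding U_def using fB' fA dj B'Bl by (intro card_UN_disjoint) auto
    then have "real (card (U s)) = (\<Sum>b\<in>B' s. real (card (A b s)))" by simp
    also have "\<dots> \<ge> (\<Sum>b\<in>B' s. 2 * w b)"
      using cardA B'Bl by (intro sum_mono) (auto simp: w_def)
    finally show ?thesis by (simp add: sum_distrib_left)
  qed
  have cardN2: "real (card N2) \<ge> 2 * (\<Sum>s\<in>S. \<Sum>b\<in>B' s. w b)"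
  proof -
    have "card N2 = (\<Sum>s\<in>S. card ({\<sigma> s} \<times> U s))"
      unfolding N2_def using fS fU inj\<sigma> by (intro card_UN_disjoint) (auto dest: inj_onD)
    then have "real (card N2) = (\<Sum>s\<in>S. real (card (U s)))" by (simp add: card_cartesian_product)
    also have "\<dots> \<ge> (\<Sum>s\<in>S. 2 * (\<Sum>b\<in>B' s. w b))" using cardU by (intro sum_mono)
    finally show ?thesis by (simp add: sum_distrib_left)
  qed
  \<comment> \<open>Second coordinates lie in \<open>S\<close> for \<open>N1\<close> and outside
    \<open>S\<close> for \<open>N2\<close>.\<close>
  have "N1 \<inter> N2 = {}" using US by (auto simp: N1_def N2_def)
  then have "card N1 + card N2 = card (N1 \<union> N2)"
    using N1R N2R fR finite_subset by (intro card_Un_disjoint[symmetric]) blast+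
  also have "\<dots> \<le> card R" using N1R N2R fR by (intro card_mono) auto
  finally have cardR: "real (card N1) + real (card N2) \<le> real (card R)" by linarith

  \<comment> \<open>The block \<open>bl s\<close> itself contributes only if it is in
    \<open>D\<close>: in a book, \<open>inact\<close> denies weight to the link vertices of the
    active vertex \<open>v\<close>.\<close>
  have own: "p s \<le> (\<Sum>b\<in>B' s. w b) + (if bl s \<in> D then 5 / 4 else 0)" if s: "s \<in> S" for s
  proof (cases "s \<in> act (bl s)")
    case True
    have *: "bl s \<in> Bl" "v \<in> act (bl s)" using bl[OF s] by (auto simp: Bv_def)
    then have "bl s \<in> D" using inact bl(2)[OF s] True by blast
    moreover have "p s = w (bl s) + (\<Sum>b\<in>B' s. w b)"
      unfolding p_def B'_def using True * fin by (intro sum.remove) auto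
    ultimately show ?thesis by (simp add: w_def)
  next
    case False
    then have "B' s = {b\<in>Bl. s \<in> act b}" by (auto simp: B'_def)
    then show ?thesis by (simp add: p_def)
  qed
  have ownsum: "(\<Sum>s\<in>S. if bl s \<in> D then 5 / 4 else 0) = 15 / 4 * real a"
  proof -
    have "(\<Sum>s\<in>S. if bl s \<in> D then 5 / 4 else 0 :: real)
        = (\<Sum>b\<in>Bv. \<Sum>s\<in>A b v. if bl s \<in> D then 5 / 4 else 0)"
      unfolding S_def using fBv fA dj by (intro sum.UNION_disjoint) (auto simp: Bv_def)
    also have "\<dots> = (\<Sum>b\<in>Bv. \<Sum>s\<in>A b v. if b \<in> D then 5 / 4 else 0)"
      using bl_eq by (intro sum.cong) auto
    also have "\<dots> = (\<Sum>b\<in>Bv. if b \<in> D then 15 / 4 else 0)" using cA by (intro sum.cong) auto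
    finally show ?thesis using split[of "15/4" 0] by simp
  qed
  \<comment> \<open>Outside \<open>S\<close> each weight is at most the maximum \<open>p v\<close>.
    On \<open>S\<close> the weight from further blocks is at most half of \<open>card N2\<close>,
    and the remaining terms are weighed against half of \<open>card N1\<close>.\<close>
  have "(\<Sum>u\<in>V. p u) = (\<Sum>u\<in>V - S. p u) + (\<Sum>s\<in>S. p s)"
    using SV fin by (intro sum.subset_diff)
  moreover have "(\<Sum>u\<in>V - S. p u) \<le> real (card (V - S)) * p v"
    using sum_bounded_above[of "V - S" p "p v"] vmax by auto
  moreover have "real (card (V - S)) = real (card V) - real (card S)"
    using SV fS fin by (simp add: card_Diff_subset card_mono of_nat_diff)
  moreover have "(\<Sum>s\<in>S. p s) \<le> (\<Sum>s\<in>S. \<Sum>b\<in>B' s. w b) + 15 / 4 * real a"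
    using sum_mono[of S p, OF own] ownsum by (simp add: sum.distrib)
  ultimately have "(\<Sum>u\<in>V. p u) \<le> p v * (real (card V) - real (card S)) + 15 / 4 * real a
      + (\<Sum>s\<in>S. \<Sum>b\<in>B' s. w b)"
    by (simp add: mult.commute)
  moreover have "p v * (real (card V) - real (card S)) + 15 / 4 * real a
      \<le> real (card N1) / 2 + (real (card V) + 2)\<^sup>2 / 16 + 5"
    using quadratic_optimization[of c a "real (card V)"] unfolding cardN1 cardS pv by simp
  ultimately have "(\<Sum>u\<in>V. p u) \<le> real (card R) / 2 + (real (card V) + 2)\<^sup>2 / 16 + 5"
    using cardR cardN2 by argo
  then show ?thesis using swap unfolding w_def by simp
qed

section \<open>Triples pairwise sharing two points\<close>

text \<open>Without a common pair there are three triples \<open>{x, y, z}\<close>,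
  \<open>{x, y, w}\<close>, \<open>{x, z, w}\<close>. They cover all pairs of the four points, and
  their only common point is \<open>x\<close>, which leaves no room for a triple reaching
  outside.\<close>

lemma dense_triple_family:
  assumes card3: "\<And>t. t \<in> \<B> \<Longrightarrow> card t = 3"
    and meet: "\<And>t t'. t \<in> \<B> \<Longrightarrow> t' \<in> \<B> \<Longrightarrow> card (t \<inter> t') \<ge> 2"
    and ne: "\<B> \<noteq> {}"
    and nopair: "\<not> (\<exists>e. card e = 2 \<and> (\<forall>t\<in>\<B>. e \<subseteq> t))"
  shows "card (\<Union>\<B>) = 4" "card \<B> \<le> 4"
    "\<And>x y. x \<in> \<Union>\<B> \<Longrightarrow> y \<in> \<Union>\<B> \<Longrightarrow> \<exists>t\<in>\<B>. x \<in> t \<and> y \<in> t"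
proof -
  have fin: "finite t" if "t \<in> \<B>" for t using card3[OF that] card.infinite by fastforce
  obtain t1 where t1: "t1 \<in> \<B>" using ne by blast
  obtain e where e: "e \<subseteq> t1" "card e = 2"
    using card3[OF t1] obtain_subset_with_card_n[of 2 t1] by auto
  then obtain t2 where t2: "t2 \<in> \<B>" "\<not> e \<subseteq> t2" using nopair by blast
  define d where "d = t1 \<inter> t2"
  have "card d \<noteq> 3" using e t2(2) fin[OF t1] card3[OF t1] card_subset_eq[of t1 d] by (auto simp: d_def)
  moreover have "card d \<le> 3" using card_mono[of t1 d] fin[OF t1] card3[OF t1] by (auto simp: d_def)
  moreover have "card d \<ge> 2" using meet[OF t1 t2(1)] by (simp add: d_def)
  ultimately have d: "card d = 2" by linarith
  then obtain t3 where t3: "t3 \<in> \<B>" "\<not> d \<subseteq> t3" using nopair by blast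
  have "card (t1 - d) = 1" "card (t2 - d) = 1"
    using d fin t1 t2(1) card3 by (auto simp: d_def card_Diff_subset_Int Int_left_commute Int_absorb)
  then obtain z w where zw: "t1 - d = {z}" "t2 - d = {w}" by (meson card_1_singletonE)
  \<comment> \<open>The names are chosen so that \<open>y\<close> is a point of \<open>d\<close>
    that \<open>t3\<close> misses; the other two points of \<open>t1\<close> and of
    \<open>t2\<close> must then lie in \<open>t3\<close>.\<close>
  obtain x y where xy: "d = {x, y}" "x \<noteq> y" "y \<notin> t3"
  proof -
    obtain x y where "d = {x, y}" "x \<noteq> y" using d by (auto simp: card_2_iff)
    then show thesis using that[of x y] that[of y x] t3(2) by auto
  qed
  have e1: "t1 = {x, y, z}" using zw(1) xy(1) d_def by blast
  have e2: "t2 = {x, y, w}" using zw(2) xy(1) d_def by blast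
  have ds: "x \<noteq> y" "z \<noteq> x" "z \<noteq> y" "w \<noteq> x" "w \<noteq> y" "z \<noteq> w"
    using xy zw d_def by auto
  have two: "card (t \<inter> {p, q}) \<le> 1" if "p \<notin> t" for t :: "'a set" and p q
  proof -
    have "t \<inter> {p, q} \<subseteq> {q}" using that by auto
    then show ?thesis using card_mono[of "{q}"] by fastforce
  qed
  have pair: "p \<in> t" if "card (t \<inter> {x', y', z'}) \<ge> 2" "{x', y', z'} = {p, q, r}" "r \<notin> t"
    for t :: "'a set" and p q r x' y' z'
  proof (rule ccontr)
    assume "p \<notin> t"
    moreover have "t \<inter> {x', y', z'} = t \<inter> {p, q}" using that by auto
    ultimately show False using two[of p t q] that(1) by simp
  qed
  have m1: "card (t \<inter> {x, y, z}) \<ge> 2" and m2: "card (t \<inter> {x, y, w}) \<ge> 2" if "t \<in> \<B>" for t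
    using meet[OF that t1] meet[OF that t2(1)] e1 e2 by auto
  have in3: "x \<in> t3" "z \<in> t3" "w \<in> t3"
    using pair[OF m1[OF t3(1)], of x z y] pair[OF m1[OF t3(1)], of z x y]
      pair[OF m2[OF t3(1)], of w x y] xy(3) by auto
  have e3: "t3 = {x, z, w}"
    using in3 ds fin[OF t3(1)] card3[OF t3(1)] by (intro card_subset_eq[symmetric]) auto
  have sub: "t \<subseteq> {x, y, z, w}" if t: "t \<in> \<B>" for t
  proof (rule ccontr)
    assume "\<not> t \<subseteq> {x, y, z, w}"
    then obtain u where u: "u \<in> t" "u \<notin> {x, y, z, w}" by blast
    have "card (t \<inter> {x, y, z, w}) \<le> card (t - {u})" using u fin[OF t] by (intro card_mono) auto
    then have le2: "card (t \<inter> {x, y, z, w}) \<le> 2" using u card3[OF t] by simp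
    \<comment> \<open>A triple with a point outside keeps at most two points in the four-set. Each
      triple inside the four-set needs two common points with it, hence contains both.\<close>
    have in_each: "t \<inter> {x, y, z, w} \<subseteq> t'" if t': "t' \<in> \<B>" "t' \<subseteq> {x, y, z, w}" for t'
    proof -
      have "t \<inter> t' = t \<inter> {x, y, z, w}"
        using t'(2) le2 meet[OF t t'(1)] fin[OF t] by (intro card_seteq) auto
      then show ?thesis by blast
    qed
    have "t \<inter> {x, y, z, w} \<subseteq> t1 \<inter> t2 \<inter> t3"
      using in_each[OF t1] in_each[OF t2(1)] in_each[OF t3(1)] e1 e2 e3 by blast
    also have "\<dots> = {x}" using e1 e2 e3 ds by auto
    finally have "card (t \<inter> {x, y, z, w}) \<le> 1" using card_mono[of "{x}"] by fastforce
    moreover have "card (t \<inter> t1) \<le> card (t \<inter> {x, y, z, w})"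
      using e1 by (intro card_mono) auto
    ultimately show False using meet[OF t t1] by linarith
  qed
  have U: "\<Union>\<B> = {x, y, z, w}" using sub t1 t2(1) t3(1) e1 e2 by blast
  then show "card (\<Union>\<B>) = 4" using ds by auto
  have "\<B> \<subseteq> {K. K \<subseteq> {x, y, z, w} \<and> card K = 3}" using sub card3 by blast
  then have "card \<B> \<le> card {K. K \<subseteq> {x, y, z, w} \<and> card K = 3}" by (intro card_mono) auto
  also have "\<dots> = card {x, y, z, w} choose 3" by (intro n_subsets) simp
  also have "\<dots> = 4" using ds by (simp add: numeral_eq_Suc)
  finally show "card \<B> \<le> 4" .
  show "\<exists>t\<in>\<B>. a \<in> t \<and> b \<in> t" if "a \<in> \<Union>\<B>" "b \<in> \<Union>\<B>" for a b
  proof -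
    have "a \<in> {x, y, z, w}" "b \<in> {x, y, z, w}" using that U by auto
    then have "(a \<in> t1 \<and> b \<in> t1) \<or> (a \<in> t2 \<and> b \<in> t2) \<or> (a \<in> t3 \<and> b \<in> t3)"
      unfolding e1 e2 e3 by auto
    then show ?thesis using t1 t2(1) t3(1) by blast
  qed
qed

section \<open>Local structure of B-free complexes\<close>

lemma inj_on_five:
  assumes "distinct [v, a, b, c, d]"
  shows "\<exists>\<phi>::nat \<Rightarrow> 'a. inj_on \<phi> {1, 2, 3, 4, 5} \<and> \<phi> 1 = v \<and> \<phi> 2 = b \<and> \<phi> 3 = a \<and> \<phi> 4 = c \<and> \<phi> 5 = d"
  using assms
  by (intro exI[of _ "\<lambda>i. if i = 1 then v else if i = 2 then b else if i = 3 then a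
        else if i = 4 then c else d"]) (auto simp: inj_on_def)

text \<open>The vertex \<open>v\<close> plays the role of 1, the edge \<open>{a, c}\<close> that of
  \<open>{3, 4}\<close>, and \<open>b\<close>, \<open>d\<close> are the images of 2 and 5.\<close>

lemma contains_B_I:
  assumes H: "simplicial_complex H" and ds: "distinct [v, a, b, c, d]"
    and E: "{v, a, b} \<in> edges H" "{v, c, d} \<in> edges H" "{a, c} \<in> edges H"
  shows "contains_copy H B_complex"
proof -
  obtain \<phi> :: "nat \<Rightarrow> 'a" where \<phi>: "inj_on \<phi> {1, 2, 3, 4, 5}"
    "\<phi> 1 = v" "\<phi> 2 = b" "\<phi> 3 = a" "\<phi> 4 = c" "\<phi> 5 = d"
    using inj_on_five[OF ds] by blast
  have "\<phi> ` e \<in> edges H" if e: "e \<in> edges B_complex" for e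
  proof -
    obtain m where m: "m \<in> {{3, 4}, {1, 2, 3}, {1, 4, 5}}" "e \<subseteq> m"
      using e by (auto simp: B_complex_def downward_closure_def)
    have "\<phi> ` m \<in> {{a, c}, {v, a, b}, {v, c, d}}" using m(1) \<phi> by auto
    then have "\<phi> ` m \<in> edges H" using E by auto
    moreover have "\<phi> ` e \<subseteq> \<phi> ` m" using m(2) by blast
    ultimately show ?thesis using H unfolding simplicial_complex_def by blast
  qed
  moreover have "\<phi> ` {1, 2, 3, 4, 5} \<subseteq> verts H"
    using \<phi> E H by (auto simp: simplicial_complex_def)
  ultimately show ?thesis
    unfolding contains_copy_def using \<phi>(1) by (intro exI[of _ \<phi>]) (auto simp: B_complex_def)
qed

locale B_free_complex =
  fixes V :: "'a set" and E :: "'a set set"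
  assumes cx: "simplicial_complex (V, E)" and finV: "finite V"
    and free: "\<not> contains_copy (V, E) B_complex"
begin

lemma edge_subset: "e \<in> E \<Longrightarrow> e \<subseteq> V"
  using cx by (auto simp: simplicial_complex_def)

lemma down_closed: "e \<in> E \<Longrightarrow> f \<subseteq> e \<Longrightarrow> f \<in> E"
  using cx by (auto simp: simplicial_complex_def)

lemma finE: "finite E"
  using edge_subset finV by (intro finite_subset[of E "Pow V"]) auto

definition T where "T = {t\<in>E. card t = 3}"

lemma fin_T: "t \<in> T \<Longrightarrow> finite t"
  by (rule card_ge_0_finite) (simp add: T_def)

text \<open>An edge from \<open>x\<close> to \<open>y\<close> would join the two triangles, which
  share only \<open>v\<close>, to a copy of \<open>B_complex\<close>.\<close>

lemma nonadjacent:
  assumes "t \<in> T" "t' \<in> T" "t \<inter> t' = {v}" "x \<in> t - {v}" "y \<in> t' - {v}"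
  shows "{x, y} \<notin> E"
proof
  assume xy: "{x, y} \<in> E"
  have other: "\<exists>b. t = {v, x, b} \<and> b \<noteq> v \<and> b \<noteq> x" if t: "t \<in> T" "v \<in> t" "x \<in> t - {v}" for t x
  proof -
    have "card (t - {v, x}) = card t - card {v, x}" using t by (intro card_Diff_subset) auto
    also have "\<dots> = 1" using t by (auto simp: T_def)
    finally have "card (t - {v, x}) = 1" .
    then obtain b where "t - {v, x} = {b}" by (meson card_1_singletonE)
    then show ?thesis using t by blast
  qed
  obtain b where b: "t = {v, x, b}" "b \<noteq> v" "b \<noteq> x" using other[of t x] assms by blast
  obtain d where d: "t' = {v, y, d}" "d \<noteq> v" "d \<noteq> y" using other[of t' y] assms by blast
  have "x \<notin> t'" "b \<notin> t'" using assms b by auto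
  then have "distinct [v, x, b, y, d]" using assms(4,5) b d by auto
  then show False using contains_B_I[OF cx, of v x b y d] xy assms(1,2) b d free by (auto simp: T_def)
qed

text \<open>All subsets of an edge are edges, so any five vertices of one edge already carry a copy
  of \<open>B_complex\<close>.\<close>

lemma card_edge_le_4:
  assumes "e \<in> E"
  shows "card e \<le> 4"
proof (rule ccontr)
  assume "\<not> card e \<le> 4"
  then obtain f where "f \<subseteq> e" "card f = 5" using obtain_subset_with_card_n[of 5 e] by auto
  moreover from this have "finite f" using card.infinite by fastforce
  ultimately obtain xs where xs: "set xs = f" "distinct xs" "length xs = 5"
    using finite_distinct_list distinct_card by metis
  then obtain v a b c d where "xs = [v, a, b, c, d]"
    by (auto simp: length_Suc_conv eval_nat_numeral)
  then have "f = {v, a, b, c, d}" "distinct [v, a, b, c, d]" using xs by auto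
  then show False
    using contains_B_I[OF cx, of v a b c d] down_closed[OF assms] \<open>f \<subseteq> e\<close> free by auto
qed

text \<open>Two pairs inside the three-element set \<open>t'\<close> share a point \<open>b\<close>.
  If \<open>t\<close> and \<open>t''\<close> met only in \<open>b\<close>, the other points
  \<open>a\<close> and \<open>d\<close> of the two pairs would form a face of \<open>t'\<close>,
  against \<open>nonadjacent\<close>.\<close>

lemma meet_trans:
  assumes t: "t \<in> T" "t' \<in> T" "t'' \<in> T" and m: "card (t \<inter> t') \<ge> 2" "card (t' \<inter> t'') \<ge> 2"
  shows "card (t \<inter> t'') \<ge> 2"
proof (rule ccontr)
  assume c: "\<not> card (t \<inter> t'') \<ge> 2"
  have f: "finite t" "finite t'" "finite t''" using t fin_T by auto
  have "card ((t \<inter> t') \<union> (t' \<inter> t'')) \<le> card t'" using f by (intro card_mono) auto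
  moreover have "card (t \<inter> t') + card (t' \<inter> t'')
      = card ((t \<inter> t') \<union> (t' \<inter> t'')) + card ((t \<inter> t') \<inter> (t' \<inter> t''))"
    using f by (intro card_Un_Int) auto
  ultimately have "card ((t \<inter> t') \<inter> (t' \<inter> t'')) \<noteq> 0" using m t by (simp add: T_def)
  then have "(t \<inter> t') \<inter> (t' \<inter> t'') \<noteq> {}" by force
  then obtain b where b: "b \<in> t" "b \<in> t'" "b \<in> t''" by blast
  have "card (t \<inter> t'') = card {b}"
    using c b f card_mono[of "t \<inter> t''" "{b}"] by auto
  then have int: "t \<inter> t'' = {b}" using b f by (intro card_subset_eq[symmetric]) auto
  have "\<exists>a\<in>X. a \<noteq> b" if "card X \<ge> 2" for X
  proof (rule ccontr)
    assume "\<not> (\<exists>a\<in>X. a \<noteq> b)"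
    then have "X \<subseteq> {b}" by auto
    then show False using card_mono[of "{b}" X] that by simp
  qed
  then obtain a d where "a \<in> t \<inter> t'" "a \<noteq> b" "d \<in> t' \<inter> t''" "d \<noteq> b" using m by meson
  moreover from this have "{a, d} \<in> E" using t(2) down_closed by (auto simp: T_def)
  ultimately show False using nonadjacent[OF t(1,3) int, of a d] by auto
qed

section \<open>Blocks of triangles, their spines and links\<close>

definition block where "block t = {t'\<in>T. card (t \<inter> t') \<ge> 2}"

definition Bl where "Bl = block ` T"

text \<open>The four-vertex blocks, characterised by having no common spine; that they have four
  vertices is shown in \<open>dense\<close>.\<close>

definition D where "D = {b\<in>Bl. \<not> (\<exists>e. card e = 2 \<and> (\<forall>t\<in>b. e \<subseteq> t))}"

text \<open>A choice is needed because a block with a single triangle has three candidates.\<close>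

definition spine where "spine b = (SOME e. card e = 2 \<and> (\<forall>t\<in>b. e \<subseteq> t))"

text \<open>In a book only the page vertices off the spine receive weight, one for each
  triangle.\<close>

definition act where "act b = (if b \<in> D then \<Union>b else \<Union>b - spine b)"

definition link where "link b v = \<Union>{t\<in>b. v \<in> t} - {v}"

lemma finT: "finite T"
  using finE by (simp add: T_def)

lemma mem_block: "t \<in> T \<Longrightarrow> t \<in> block t"
  by (simp add: block_def T_def)

lemma block_eq:
  assumes "t \<in> T" "t' \<in> T" "card (t \<inter> t') \<ge> 2"
  shows "block t = block t'"
proof -
  have "card (t' \<inter> t) \<ge> 2" using assms(3) by (simp add: Int_commute)
  then show ?thesis
    unfolding block_def using meet_trans assms by blast
qed

lemma Bl_T: "b \<in> Bl \<Longrightarrow> b \<subseteq> T"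
  by (auto simp: Bl_def block_def)

lemma Bl_eq_block:
  assumes "b \<in> Bl" "t \<in> b"
  shows "b = block t"
proof -
  obtain t' where "t' \<in> T" "b = block t'" using assms by (auto simp: Bl_def)
  then show ?thesis using block_eq[of t' t] assms(2) by (auto simp: block_def)
qed

lemma Bl_meet: "b \<in> Bl \<Longrightarrow> t \<in> b \<Longrightarrow> t' \<in> b \<Longrightarrow> card (t \<inter> t') \<ge> 2"
  using Bl_eq_block[of b t] unfolding block_def by blast

lemma Bl_nonempty: "b \<in> Bl \<Longrightarrow> b \<noteq> {}"
  unfolding Bl_def using mem_block by blast

lemma Bl_disjoint_meet:
  assumes "b \<in> Bl" "b' \<in> Bl" "b \<noteq> b'" "t \<in> b" "t' \<in> b'" "v \<in> t" "v \<in> t'"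
  shows "t \<inter> t' = {v}"
proof -
  have T: "t \<in> T" "t' \<in> T" using assms Bl_T by auto
  have "\<not> card (t \<inter> t') \<ge> 2" using block_eq[OF T] Bl_eq_block assms by blast
  then show ?thesis
    using assms(6,7) fin_T[OF T(1)] card_mono[of "t \<inter> t'" "{v}"]
    by (intro card_subset_eq[symmetric]) auto
qed

lemma spine:
  assumes "b \<in> Bl" "b \<notin> D"
  shows "card (spine b) = 2" "\<And>t. t \<in> b \<Longrightarrow> spine b \<subseteq> t"
proof -
  have "\<exists>e. card e = 2 \<and> (\<forall>t\<in>b. e \<subseteq> t)" using assms by (auto simp: D_def)
  from someI_ex[OF this] show "card (spine b) = 2" "\<And>t. t \<in> b \<Longrightarrow> spine b \<subseteq> t"
    unfolding spine_def by blast+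
qed

lemma page_triple:
  assumes "b \<in> Bl" "b \<notin> D" "t \<in> b" "v \<in> t" "v \<notin> spine b"
  shows "t = insert v (spine b)"
proof -
  have s: "card (spine b) = 2" "spine b \<subseteq> t" using spine assms by auto
  have t: "t \<in> T" using assms Bl_T by blast
  have "finite (spine b)" using s(2) fin_T[OF t] finite_subset by blast
  then have "card (insert v (spine b)) = card t" using s(1) t assms(5) by (simp add: T_def)
  then show ?thesis
    using s(2) assms(4) fin_T[OF t] by (intro card_subset_eq[symmetric]) auto
qed

lemma dense:
  assumes "b \<in> D"
  shows "card (\<Union>b) = 4" "card b \<le> 4"
    "\<And>x y. x \<in> \<Union>b \<Longrightarrow> y \<in> \<Union>b \<Longrightarrow> \<exists>t\<in>b. x \<in> t \<and> y \<in> t"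
proof -
  have b: "b \<in> Bl" "\<not> (\<exists>e. card e = 2 \<and> (\<forall>t\<in>b. e \<subseteq> t))" using assms by (auto simp: D_def)
  have 3: "\<And>t. t \<in> b \<Longrightarrow> card t = 3" using Bl_T[OF b(1)] by (auto simp: T_def)
  note * = dense_triple_family[OF 3 Bl_meet[OF b(1)] Bl_nonempty[OF b(1)] b(2)]
  show "card (\<Union>b) = 4" by (rule *(1))
  show "card b \<le> 4" by (rule *(2))
  show "\<exists>t\<in>b. x \<in> t \<and> y \<in> t" if "x \<in> \<Union>b" "y \<in> \<Union>b" for x y using *(3) that by blast
qed

text \<open>The only triangle of a book through an active vertex is its own page.\<close>

lemma link_spine:
  assumes "b \<in> Bl" "b \<notin> D" "v \<in> act b"
  shows "link b v = spine b"
proof -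
  have v: "v \<in> \<Union>b" "v \<notin> spine b" using assms by (auto simp: act_def)
  have "{t\<in>b. v \<in> t} = {insert v (spine b)}"
    using page_triple[OF assms(1,2) _ _ v(2)] v(1) by blast
  then show ?thesis using v(2) by (auto simp: link_def)
qed

lemma link_dense:
  assumes "b \<in> D" "v \<in> \<Union>b"
  shows "link b v = \<Union>b - {v}"
  using dense(3)[OF assms(1) assms(2)] by (auto simp: link_def)

text \<open>Pairs are ordered, so that products of links are subsets of \<open>R\<close>; each
  missing pair counts twice, hence the factor 1/2 in the bounds.\<close>

definition R where "R = {(x, y). x \<in> V \<and> y \<in> V \<and> x \<noteq> y \<and> {x, y} \<notin> E}"

text \<open>Triangles from different blocks through \<open>v\<close> meet only in \<open>v\<close>,
  so \<open>nonadjacent\<close> applies to them.\<close>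

lemma link_separated:
  assumes "b \<in> Bl" "b' \<in> Bl" "b \<noteq> b'" "x \<in> link b v" "y \<in> link b' v"
  shows "x \<noteq> y" "(x, y) \<in> R"
proof -
  obtain t where t: "t \<in> b" "v \<in> t" "x \<in> t - {v}" using assms by (auto simp: link_def)
  obtain t' where t': "t' \<in> b'" "v \<in> t'" "y \<in> t' - {v}" using assms by (auto simp: link_def)
  have T: "t \<in> T" "t' \<in> T" using assms t t' Bl_T by auto
  have i: "t \<inter> t' = {v}" using Bl_disjoint_meet assms t t' by blast
  show "x \<noteq> y" using i t t' by blast
  moreover have "{x, y} \<notin> E" using nonadjacent[OF T i t(3) t'(3)] .
  ultimately show "(x, y) \<in> R" using T t t' edge_subset by (auto simp: R_def T_def)
qed

lemma block_weight_bound: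
  "(\<Sum>b\<in>Bl. (if b \<in> D then 5 / 4 else 1) * real (card (act b)))
     \<le> real (card R) / 2 + (real (card V) + 2)\<^sup>2 / 16 + 5"
proof (rule weighted_block_bound[where A = link])
  show "finite V" by (rule finV)
  show "finite Bl" using finT by (simp add: Bl_def)
  have UV: "\<Union>b \<subseteq> V" if "b \<in> Bl" for b using Bl_T[OF that] edge_subset by (auto simp: T_def)
  show "act b \<subseteq> V" if "b \<in> Bl" for b using UV[OF that] by (auto simp: act_def)
  show "R \<subseteq> V \<times> V" by (auto simp: R_def)
  show "link b v \<subseteq> V" if "b \<in> Bl" for b v using UV[OF that] by (auto simp: link_def)
  show "v \<notin> link b v" for b v by (simp add: link_def)
  show "card (link b v) = (if b \<in> D then 3 else 2)" if "b \<in> Bl" "v \<in> act b" for b v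
  proof (cases "b \<in> D")
    case True
    then have "v \<in> \<Union>b" using that by (simp add: act_def)
    then show ?thesis using True link_dense[OF True] dense(1)[OF True] by (simp add: card_Diff_singleton)
  next
    case False
    then show ?thesis using link_spine[OF that(1) False that(2)] spine(1)[OF that(1) False] by simp
  qed
  show "link b v \<inter> link b' v = {}" if "b \<in> Bl" "b' \<in> Bl" "b \<noteq> b'" for b b' v
    using link_separated(1)[OF that] by blast
  show "link b v \<times> link b' v \<subseteq> R" if "b \<in> Bl" "b' \<in> Bl" "b \<noteq> b'" for b b' v
    using link_separated(2)[OF that] by blast
  show "(v, s) \<notin> R" if "b \<in> Bl" "s \<in> link b v" for b v s
  proof -
    obtain t where "t \<in> b" "v \<in> t" "s \<in> t" using \<open>s \<in> link b v\<close> by (auto simp: link_def)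
    then have "{v, s} \<in> E" using Bl_T[OF that(1)] down_closed[of t] by (auto simp: T_def)
    then show ?thesis by (simp add: R_def)
  qed
  show "s \<notin> act b" if "b \<in> Bl" "b \<notin> D" "v \<in> act b" "s \<in> link b v" for b v s
    using link_spine[OF that(1-3)] that by (simp add: act_def)
  show "insert v (link b v) - {s} \<subseteq> link b s" if "b \<in> Bl" "v \<in> act b" "s \<in> link b v" for b v s
  proof (cases "b \<in> D")
    case True
    then have "v \<in> \<Union>b" using that by (simp add: act_def)
    then show ?thesis using link_dense[OF True] that(3) by auto
  next
    case False
    have v: "v \<in> \<Union>b" "v \<notin> spine b" using that False by (auto simp: act_def)
    then have "insert v (spine b) \<in> b" using page_triple[OF that(1) False _ _ v(2)] by fastforce
    then show ?thesis using link_spine[OF that(1) False that(2)] that(3) by (auto simp: link_def)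
  qed
qed

section \<open>Counting edges by size\<close>

text \<open>The four triangles of a 4-edge \<open>q\<close> share pairs, so they lie in one block.
  They have no common vertex, so the block is in \<open>D\<close> and its vertex set is exactly
  \<open>q\<close>.\<close>

lemma card_four_edges: "card {q\<in>E. card q = 4} \<le> card D"
proof -
  have finD: "finite D" using finT by (simp add: D_def Bl_def)
  have "{q\<in>E. card q = 4} \<subseteq> Union ` D"
  proof
    fix q assume "q \<in> {q\<in>E. card q = 4}"
    then have q: "q \<in> E" "card q = 4" by auto
    then have fq: "finite q" using edge_subset finV finite_subset by blast
    have qT: "q - {x} \<in> T" if "x \<in> q" for x
      using q fq that down_closed[OF q(1)] by (auto simp: T_def)
    obtain x where x: "x \<in> q" using q by fastforce
    have in_b: "q - {y} \<in> block (q - {x})" if "y \<in> q" for y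
    proof -
      have "card (q - {x, y}) \<ge> card q - card {x, y}" by (intro diff_card_le_card_Diff) simp
      moreover have "card {x, y} \<le> 2" by (simp add: card_insert_if)
      moreover have "(q - {x}) \<inter> (q - {y}) = q - {x, y}" by auto
      ultimately show ?thesis using qT[OF that] q by (simp add: block_def)
    qed
    have bB: "block (q - {x}) \<in> Bl" using qT[OF x] by (simp add: Bl_def)
    have "block (q - {x}) \<in> D"
    proof (rule ccontr)
      assume "block (q - {x}) \<notin> D"
      note s = spine[OF bB this]
      \<comment> \<open>A spine would have to avoid every \<open>y\<close> in \<open>q\<close> and
        still lie inside \<open>q\<close>.\<close>
      have "spine (block (q - {x})) \<subseteq> q - {y}" if "y \<in> q" for y using s(2)[OF in_b[OF that]] .
      then have "spine (block (q - {x})) = {}" using x by blast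
      then show False using s(1) by simp
    qed
    moreover have "q \<subseteq> \<Union>(block (q - {x}))"
    proof
      fix y assume y: "y \<in> q"
      have "card (q - {y}) = 3" using q y by simp
      then have "q - {y} \<noteq> {}" by force
      then obtain z where "z \<in> q" "z \<noteq> y" by blast
      then show "y \<in> \<Union>(block (q - {x}))" using in_b[of z] y by blast
    qed
    moreover have "finite (\<Union>(block (q - {x})))"
      using dense(1)[OF \<open>block (q - {x}) \<in> D\<close>] card.infinite by fastforce
    ultimately have "q = \<Union>(block (q - {x}))"
      using dense(1) q by (intro card_subset_eq) auto
    then show "q \<in> Union ` D" using \<open>block (q - {x}) \<in> D\<close> by blast
  qed
  then have "card {q\<in>E. card q = 4} \<le> card (Union ` D)" using finD by (intro card_mono) auto
  also have "\<dots> \<le> card D" using finD by (rule card_image_le)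
  finally show ?thesis .
qed

text \<open>The blocks partition \<open>T\<close>. A block in \<open>D\<close> has at most four
  triangles and is charged one 4-edge, in total \<open>5 = 4 * 5/4\<close>; in a book every triangle
  is determined by its active vertex.\<close>

lemma card_T_plus_four_edges:
  "real (card T) + real (card {q\<in>E. card q = 4})
     \<le> (\<Sum>b\<in>Bl. (if b \<in> D then 5 / 4 else 1) * real (card (act b)))"
proof -
  have finBl: "finite Bl" using finT by (simp add: Bl_def)
  have "T = \<Union>Bl" using Bl_T mem_block by (auto simp: Bl_def)
  also have "card (\<Union>Bl) = (\<Sum>b\<in>Bl. card b)"
  proof (rule card_Union_disjoint)
    show "pairwise disjnt Bl" unfolding pairwise_def disjnt_def using Bl_eq_block by blast
    show "finite b" if "b \<in> Bl" for b using Bl_T[OF that] finT finite_subset by blast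
  qed
  finally have T: "real (card T) = (\<Sum>b\<in>Bl. real (card b))" by simp
  have "D \<subseteq> Bl" by (auto simp: D_def)
  then have "real (card D) = (\<Sum>b\<in>Bl. if b \<in> D then 1 else 0)"
    using finBl by (simp add: sum.If_cases Int_absorb1 Int_commute)
  then have "real (card T) + real (card {q\<in>E. card q = 4})
      \<le> (\<Sum>b\<in>Bl. real (card b) + (if b \<in> D then 1 else 0))"
    using card_four_edges T by (simp add: sum.distrib)
  also have "\<dots> \<le> (\<Sum>b\<in>Bl. (if b \<in> D then 5 / 4 else 1) * real (card (act b)))"
  proof (rule sum_mono)
    fix b assume b: "b \<in> Bl"
    show "real (card b) + (if b \<in> D then 1 else 0) \<le> (if b \<in> D then 5 / 4 else 1) * real (card (act b))"
    proof (cases "b \<in> D")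
      case True
      then show ?thesis using dense(1,2)[OF True] by (simp add: act_def)
    next
      case False
      have "b \<subseteq> (\<lambda>v. insert v (spine b)) ` act b"
      proof
        fix t assume t: "t \<in> b"
        have "card (spine b) = 2" "card t = 3" using spine[OF b False] t Bl_T[OF b] by (auto simp: T_def)
        then have "t \<noteq> spine b" by auto
        then obtain v where v: "v \<in> t" "v \<notin> spine b" using spine(2)[OF b False t] by blast
        then have "t = insert v (spine b)" using page_triple[OF b False t] by blast
        moreover have "v \<in> act b" using v t False by (auto simp: act_def)
        ultimately show "t \<in> (\<lambda>v. insert v (spine b)) ` act b" by blast
      qed
      moreover have "finite (act b)"
        using Bl_T[OF b] fin_T finT finite_subset[of b T] by (auto simp: act_def)
      ultimately have "card b \<le> card (act b)" by (rule surj_card_le[rotated])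
      then show ?thesis using False by simp
    qed
  qed
  finally show ?thesis .
qed

text \<open>Each unordered missing pair yields at most two elements of \<open>R\<close>, and the
  missing pairs together with the 2-edges are all pairs of vertices.\<close>

lemma card_graph_edges: "real (card {e\<in>E. card e = 2}) \<le> real (card V choose 2) - real (card R) / 2"
proof -
  define P where "P = {e. e \<subseteq> V \<and> card e = 2 \<and> e \<notin> E}"
  have finP: "finite P" using finV by (simp add: P_def)
  have "R \<subseteq> (\<Union>e\<in>P. {(x, y). {x, y} = e})"
  proof
    fix z assume "z \<in> R"
    then obtain x y where "z = (x, y)" "x \<in> V" "y \<in> V" "x \<noteq> y" "{x, y} \<notin> E" by (auto simp: R_def)
    then have "{x, y} \<in> P" "z \<in> {(x', y'). {x', y'} = {x, y}}" by (auto simp: P_def)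
    then show "z \<in> (\<Union>e\<in>P. {(x, y). {x, y} = e})" by blast
  qed
  moreover have two: "finite {(x, y). {x, y} = e} \<and> card {(x, y). {x, y} = e} \<le> 2" if "e \<in> P" for e
  proof -
    obtain a b where ab: "e = {a, b}" using \<open>e \<in> P\<close> by (auto simp: P_def card_2_iff)
    have sub: "{(x, y). {x, y} = e} \<subseteq> {(a, b), (b, a)}"
      unfolding ab by (auto simp: doubleton_eq_iff)
    have "card {(x, y). {x, y} = e} \<le> card {(a, b), (b, a)}" using sub by (intro card_mono) auto
    also have "\<dots> \<le> 2" using card_length[of "[(a, b), (b, a)]"] by simp
    finally have "card {(x, y). {x, y} = e} \<le> 2" .
    moreover have "finite {(x, y). {x, y} = e}" by (rule finite_subset[OF sub]) simp
    ultimately show ?thesis by (rule conjI[rotated])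
  qed
  moreover have "finite (\<Union>e\<in>P. {(x, y). {x, y} = e})" using finP two by (intro finite_UN_I) blast+
  ultimately have "card R \<le> card (\<Union>e\<in>P. {(x, y). {x, y} = e})" by (intro card_mono)
  also have "\<dots> \<le> (\<Sum>e\<in>P. card {(x, y). {x, y} = e})" using finP by (rule card_UN_le)
  also have "\<dots> \<le> (\<Sum>e\<in>P. 2)" using two by (intro sum_mono) blast
  also have "\<dots> = card P * 2" by simp
  finally have R: "card R \<le> card P * 2" .
  have "card {e\<in>E. card e = 2} + card P = card ({e\<in>E. card e = 2} \<union> P)"
    using finE finP by (intro card_Un_disjoint[symmetric]) (auto simp: P_def)
  also have "{e\<in>E. card e = 2} \<union> P = {e. e \<subseteq> V \<and> card e = 2}"
    using edge_subset by (auto simp: P_def)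
  also have "card \<dots> = card V choose 2" using finV by (rule n_subsets)
  finally show ?thesis using R by linarith
qed

text \<open>The term \<open>card R / 2\<close> lost by the 2-edges cancels the one gained by
  triangles and 4-edges. The empty edge adds 1 and the singletons at most
  \<open>card V\<close>.\<close>

lemma card_edges_bound:
  "real (card E) \<le> 9 / 8 * real (card V choose 2) + 21 / 16 * real (card V) + 7"
proof -
  have "E \<subseteq> {{}} \<union> {e. e \<subseteq> V \<and> card e = 1} \<union> {e\<in>E. card e = 2} \<union> T \<union> {q\<in>E. card q = 4}"
  proof
    fix e assume e: "e \<in> E"
    then have "e = {} \<or> card e \<noteq> 0" using edge_subset finV finite_subset by fastforce
    moreover have "card e \<le> 4" using card_edge_le_4[OF e] .
    ultimately have "e = {} \<or> card e = 1 \<or> card e = 2 \<or> card e = 3 \<or> card e = 4" by linarith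
    then show "e \<in> {{}} \<union> {e. e \<subseteq> V \<and> card e = 1} \<union> {e\<in>E. card e = 2} \<union> T \<union> {q\<in>E. card q = 4}"
      using e edge_subset by (auto simp: T_def)
  qed
  then have "card E \<le> card ({{}} \<union> {e. e \<subseteq> V \<and> card e = 1} \<union> {e\<in>E. card e = 2} \<union> T \<union> {q\<in>E. card q = 4})"
    using finE finT finV by (intro card_mono) auto
  also have "\<dots> \<le> card {{}::'a set} + card {e. e \<subseteq> V \<and> card e = 1} + card {e\<in>E. card e = 2}
      + card T + card {q\<in>E. card q = 4}"
    by (intro order.trans[OF card_Un_le] add_mono order.refl)
  also have "card {e. e \<subseteq> V \<and> card e = 1} = card V" using n_subsets[OF finV, of 1] by simp
  finally have "real (card E) \<le> 1 + real (card V) + real (card {e\<in>E. card e = 2}) + real (card T)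
      + real (card {q\<in>E. card q = 4})" by simp
  also have "\<dots> \<le> 6 + real (card V) + real (card V choose 2) + (real (card V) + 2)\<^sup>2 / 16"
    using card_graph_edges card_T_plus_four_edges block_weight_bound by linarith
  \<comment> \<open>With \<open>n = card V\<close>, \<open>(n + 2)^2 / 16\<close> equals one eighth
    of \<open>n choose 2\<close> plus \<open>5/16 * n + 1/4\<close>; the constant 6 + 1/4 is rounded
    up to 7.\<close>
  also have "\<dots> \<le> 9 / 8 * real (card V choose 2) + 21 / 16 * real (card V) + 7"
  proof -
    have "2 * real (card V choose 2) = real (card V) * (real (card V) - 1)"
      by (cases "card V") (auto simp: choose_two real_of_nat_div algebra_simps)
    then show ?thesis by (simp add: power2_eq_square field_simps)
  qed
  finally show ?thesis .
qed

end

theorem theorem1p2: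
  shows "\<exists>C::nat. \<forall>n::nat. n \<ge> 5 \<longrightarrow>
    real (ex_number n B_complex) \<le> 9 / 8 * real (n choose 2) + 21 / 16 * real n + real C"
proof (intro exI[of _ 7] allI impI)
  fix n :: nat
  have "edges B_complex \<noteq> {}" by (auto simp: B_complex_def downward_closure_def)
  \<comment> \<open>The maximum is attained, so it suffices to bound the edges of one extremal
    complex.\<close>
  from Max_in[OF finite_ex_number_set ex_number_set_nonempty[OF this], of n]
  obtain H :: "nat complex_pair" where H: "simplicial_complex H" "finite (verts H)" "card (verts H) = n"
    "\<not> contains_copy H B_complex" and ex: "ex_number n B_complex = card (edges H)"
    unfolding ex_number_def by blast
  interpret B_free_complex "verts H" "edges H"
    using H by unfold_locales simp_all
  show "real (ex_number n B_complex) \<le> 9 / 8 * real (n choose 2) + 21 / 16 * real n + real 7"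
    using card_edges_bound ex H(3) by simp
qed

end
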